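(* Let $(s,\pi)$ be a slope-level pair on a finite connected graph $G=(V,E)$. Then $\mathring\sigma_{s,\pi}$ is the set of edge length functions $\ell\colon E\to\mathbb R_{>0}$ which are compatible with $(s,\pi)$, that is, $\mathring\sigma_{s,\pi}=\mathring{\mathcal C}_{s,\pi}$. In particular, $\mathring\sigma_{s,\pi}$ is nonempty if and only if $\sigma_{s,\pi}=\mathcal C_{s,\pi}$, in which case $\mathring\sigma_{s,\pi}$ is the relative interior of $\sigma_{s,\pi}$.
   Context: Graphs. $\mathbb E$ is the set of arrows of $G$: each edge $\{u,v\}$ gives two arrows (also if a loop); $a=uv$ has tail $u$, head $v$, reverse $\bar a$. A circuit in a graph is a collection of arrows that can be ordered $a_1,\dots,a_k$ so that the head of $a_i$ is the tail of $a_{i+1}$ for $i<k$, the head of $a_k$ is the tail of $a_1$, and the tails of the $a_i$ are pairwise distinct. Slope-level pairs. A level structure $\pi$ on $G$ is a surjection from $V$ onto a totally ordered set $(V_\pi,\prec_\pi)$ (an ordered partition of $V$). Edges joining vertices of the same level are horizontal for $\pi$, the others vertical. $A_\pi$ is the set of arrows $a=uv$ whose head $v$ has smaller level than $u$ ($v\prec_\pi u$). A slope function is $s\colon\mathbb E\to\mathbb Z$ with $s(a)+s(\bar a)\in\{-1,0\}$ for all $a$; $A_s=\{a\mid s(\bar a)<0\}$; an arrow or edge is integer for $s$ if $s(a)+s(\bar a)=0$. $(s,\pi)$ is a slope-level pair if $A_s=A_\pi$. Cones. For $\ell\in\mathbb R^E_{>0}$ and $h\colon V\to\mathbb R$, $s_h(a)=\lfloor(h(u)-h(v))/\ell_a\rfloor$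 for $a=uv$, with $\ell_a$ the length of the edge underlying $a$; $\pi_h$ is the level structure whose parts are the fibers of $h$ ordered by value. $\mathring\sigma_{s,\pi}=\{\ell\in\mathbb R^E_{>0}\mid\exists h\colon V\to\mathbb R\text{ with }s_h=s,\ \pi_h=\pi\}$ and $\sigma_{s,\pi}$ is its closure in $\mathbb R^E_{\ge0}$. Auxiliary graphs. $G_\pi=(V_\pi,E_\pi)$ is obtained from $G$ by removing the horizontal edges for $\pi$ and identifying vertices of the same level. $G_\pi^\dagger$ is obtained from $G_\pi$ by adding one extra edge (a ghost edge) between any two distinct vertices; arrows on ghost edges are ghost arrows. $G^{\rm int}_{s,\pi}$ is the spanning subgraph of $G_\pi$ whose edges are the (vertical) edges integer for $s$; it has no ghost edges. Extend $s$ to ghost arrows by $s(uv)=-\infty$ if $u\prec_\pi v$ and $s(uv)=0$ otherwise; extend each $\ell\in\mathbb R^E_{\ge0}$ to ghost edges by $\ell_e=1$. $\ell\in\mathbb R^E_{>0}$ is compatible with $(s,\pi)$ if for each circuit $q$ in $G^\dagger_\pi$ we have $\sum_{a\in q}\ell_as(a)\le0$, with equality if and only if all the arrows of $q$ are in $G^{\rm int}_{s,\pi}$. $\mathring{\mathcal C}_{s,\pi}$ is the set of compatible $\ell\in\mathbb R^E_{>0}$, and $\mathcal C_{s,\pi}$ is the set of $\ell\in\mathbb R^E_{\ge0}$ with $\sum_{a\in q}\ell_as(a)\le0$ for all circuits $q$ in $G^\dagger_\pi$. *)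

theory Defs
  imports "HOL-Analysis.Analysis" "Graph_Theory.Graph_Theory"
begin

text \<open>
  An undirected multigraph, possibly with loops, is a \<open>pre_digraph\<close> whose \<open>arcs\<close> are the edges,
  each with an arbitrarily chosen orientation. The two arrows of an edge \<open>e\<close> are
  \<open>(e, True)\<close>, which follows the chosen orientation, and \<open>(e, False)\<close>; they differ also if
  \<open>e\<close> is a loop.
\<close>

definition arrow_digraph :: "('v, 'e) pre_digraph \<Rightarrow> ('v, 'e \<times> bool) pre_digraph" where
  "arrow_digraph G = \<lparr>
     verts = verts G,
     arcs = arcs G \<times> UNIV,
     tail = (\<lambda>(e, b). if b then tail G e else head G e),
     head = (\<lambda>(e, b). if b then head G e else tail G e)\<rparr>"

abbreviation arrows :: "('v, 'e) pre_digraph \<Rightarrow> ('e \<times> bool) set" where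
  "arrows G \<equiv> arcs (arrow_digraph G)"

abbreviation arrow_tail :: "('v, 'e) pre_digraph \<Rightarrow> 'e \<times> bool \<Rightarrow> 'v" where
  "arrow_tail G \<equiv> tail (arrow_digraph G)"

abbreviation arrow_head :: "('v, 'e) pre_digraph \<Rightarrow> 'e \<times> bool \<Rightarrow> 'v" where
  "arrow_head G \<equiv> head (arrow_digraph G)"

definition reverse :: "'e \<times> bool \<Rightarrow> 'e \<times> bool" where
  "reverse a = (fst a, \<not> snd a)"

definition circuit :: "('v, 'e) pre_digraph \<Rightarrow> ('e \<times> bool) set \<Rightarrow> bool" where
  "circuit G q \<longleftrightarrow> (\<exists>as. as \<noteq> [] \<and> set as = q \<and> q \<subseteq> arrows G \<and>
     (\<forall>i. Suc i < length as \<longrightarrow> arrow_head G (as ! i) = arrow_tail G (as ! Suc i)) \<and>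
     arrow_head G (last as) = arrow_tail G (hd as) \<and>
     distinct (map (arrow_tail G) as))"


text \<open>
  A level structure is a map \<open>\<pi>\<close> from the vertices to a linear order; the totally ordered set
  of its levels is \<open>\<pi> ` verts G\<close>. Level structures are identified when they are the same ordered
  partition of the vertices.
\<close>

definition same_levels ::
  "('v, 'e) pre_digraph \<Rightarrow> ('v \<Rightarrow> 'k::linorder) \<Rightarrow> ('v \<Rightarrow> 'l::linorder) \<Rightarrow> bool" where
  "same_levels G \<pi> \<pi>' \<longleftrightarrow> (\<forall>u \<in> verts G. \<forall>v \<in> verts G.
     (\<pi> u = \<pi> v \<longleftrightarrow> \<pi>' u = \<pi>' v) \<and> (\<pi> u < \<pi> v \<longleftrightarrow> \<pi>' u < \<pi>' v))"

definition level_arrows ::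
  "('v, 'e) pre_digraph \<Rightarrow> ('v \<Rightarrow> 'l::linorder) \<Rightarrow> ('e \<times> bool) set" where
  "level_arrows G \<pi> = {a \<in> arrows G. \<pi> (arrow_head G a) < \<pi> (arrow_tail G a)}"

definition slope_function :: "('v, 'e) pre_digraph \<Rightarrow> ('e \<times> bool \<Rightarrow> int) \<Rightarrow> bool" where
  "slope_function G s \<longleftrightarrow> (\<forall>a \<in> arrows G. s a + s (reverse a) \<in> {-1, 0})"

definition slope_arrows ::
  "('v, 'e) pre_digraph \<Rightarrow> ('e \<times> bool \<Rightarrow> int) \<Rightarrow> ('e \<times> bool) set" where
  "slope_arrows G s = {a \<in> arrows G. s (reverse a) < 0}"

definition slope_level_pair ::
  "('v, 'e) pre_digraph \<Rightarrow> ('e \<times> bool \<Rightarrow> int) \<Rightarrow> ('v \<Rightarrow> 'l::linorder) \<Rightarrow> bool" where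
  "slope_level_pair G s \<pi> \<longleftrightarrow> slope_function G s \<and> slope_arrows G s = level_arrows G \<pi>"


text \<open>
  The space of real functions on the edges is the subspace of \<open>real ^ 'e\<close> of vectors supported
  on \<open>arcs G\<close>. As \<open>arcs G\<close> need not be the whole type, graphs without edges are included.
\<close>

definition nonneg_lengths :: "('v, 'e::finite) pre_digraph \<Rightarrow> (real ^ 'e) set" where
  "nonneg_lengths G = {l. (\<forall>e \<in> arcs G. 0 \<le> l $ e) \<and> (\<forall>e. e \<notin> arcs G \<longrightarrow> l $ e = 0)}"

definition pos_lengths :: "('v, 'e::finite) pre_digraph \<Rightarrow> (real ^ 'e) set" where
  "pos_lengths G = {l. (\<forall>e \<in> arcs G. 0 < l $ e) \<and> (\<forall>e. e \<notin> arcs G \<longrightarrow> l $ e = 0)}"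

definition slope_of ::
  "('v, 'e::finite) pre_digraph \<Rightarrow> real ^ 'e \<Rightarrow> ('v \<Rightarrow> real) \<Rightarrow> 'e \<times> bool \<Rightarrow> int" where
  "slope_of G l h a = \<lfloor>(h (arrow_tail G a) - h (arrow_head G a)) / l $ fst a\<rfloor>"

text \<open>The level structure of \<open>h\<close> is \<open>h\<close> itself, with levels in \<open>real\<close>.\<close>

definition open_sigma ::
  "('v, 'e::finite) pre_digraph \<Rightarrow> ('e \<times> bool \<Rightarrow> int) \<Rightarrow> ('v \<Rightarrow> 'l::linorder) \<Rightarrow> (real ^ 'e) set"
where
  "open_sigma G s \<pi> = {l \<in> pos_lengths G. \<exists>h :: 'v \<Rightarrow> real.
     (\<forall>a \<in> arrows G. slope_of G l h a = s a) \<and> same_levels G h \<pi>}"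

definition closed_sigma ::
  "('v, 'e::finite) pre_digraph \<Rightarrow> ('e \<times> bool \<Rightarrow> int) \<Rightarrow> ('v \<Rightarrow> 'l::linorder) \<Rightarrow> (real ^ 'e) set"
where
  "closed_sigma G s \<pi> = (top_of_set (nonneg_lengths G)) closure_of (open_sigma G s \<pi>)"


definition level_graph ::
  "('v, 'e) pre_digraph \<Rightarrow> ('v \<Rightarrow> 'l::linorder) \<Rightarrow> ('l, 'e) pre_digraph" where
  "level_graph G \<pi> = \<lparr>
     verts = \<pi> ` verts G,
     arcs = {e \<in> arcs G. \<pi> (tail G e) \<noteq> \<pi> (head G e)},
     tail = \<pi> \<circ> tail G,
     head = \<pi> \<circ> head G\<rparr>"

text \<open>
  The ghost edge between two distinct levels \<open>x < y\<close> is \<open>Inr (x, y)\<close>, oriented from \<open>x\<close> to \<open>y\<close>.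
\<close>

definition ghost_graph ::
  "('v, 'e) pre_digraph \<Rightarrow> ('v \<Rightarrow> 'l::linorder) \<Rightarrow> ('l, 'e + 'l \<times> 'l) pre_digraph" where
  "ghost_graph G \<pi> = \<lparr>
     verts = verts (level_graph G \<pi>),
     arcs = Inl ` arcs (level_graph G \<pi>) \<union>
            Inr ` {(x, y). x \<in> verts (level_graph G \<pi>) \<and> y \<in> verts (level_graph G \<pi>) \<and> x < y},
     tail = case_sum (tail (level_graph G \<pi>)) fst,
     head = case_sum (head (level_graph G \<pi>)) snd\<rparr>"

definition integer_graph ::
  "('v, 'e) pre_digraph \<Rightarrow> ('e \<times> bool \<Rightarrow> int) \<Rightarrow> ('v \<Rightarrow> 'l::linorder) \<Rightarrow> ('l, 'e) pre_digraph"
where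
  "integer_graph G s \<pi> = (level_graph G \<pi>)
     \<lparr>arcs := {e \<in> arcs (level_graph G \<pi>). s (e, True) + s (e, False) = 0}\<rparr>"

definition ext_slope ::
  "('v, 'e) pre_digraph \<Rightarrow> ('e \<times> bool \<Rightarrow> int) \<Rightarrow> ('v \<Rightarrow> 'l::linorder) \<Rightarrow>
    ('e + 'l \<times> 'l) \<times> bool \<Rightarrow> ereal" where
  "ext_slope G s \<pi> a = (case fst a of
      Inl e \<Rightarrow> ereal (real_of_int (s (e, snd a)))
    | Inr g \<Rightarrow> (if arrow_tail (ghost_graph G \<pi>) a < arrow_head (ghost_graph G \<pi>) a
                then -\<infinity> else 0))"

definition ext_length :: "real ^ 'e::finite \<Rightarrow> 'e + 'l \<times> 'l \<Rightarrow> real" where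
  "ext_length l e = (case e of Inl e' \<Rightarrow> l $ e' | Inr g \<Rightarrow> 1)"

text \<open>
  The sum lives in \<open>ereal\<close>, because of the slope \<open>-\<infinity>\<close>; for \<open>l\<close> nonnegative no term
  is \<open>\<infinity>\<close>.
\<close>

definition circuit_sum ::
  "('v, 'e::finite) pre_digraph \<Rightarrow> ('e \<times> bool \<Rightarrow> int) \<Rightarrow> ('v \<Rightarrow> 'l::linorder) \<Rightarrow> real ^ 'e \<Rightarrow>
    (('e + 'l \<times> 'l) \<times> bool) set \<Rightarrow> ereal" where
  "circuit_sum G s \<pi> l q = (\<Sum>a \<in> q. ereal (ext_length l (fst a)) * ext_slope G s \<pi> a)"

definition compatible ::
  "('v, 'e::finite) pre_digraph \<Rightarrow> ('e \<times> bool \<Rightarrow> int) \<Rightarrow> ('v \<Rightarrow> 'l::linorder) \<Rightarrow> real ^ 'e \<Rightarrow> bool"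
where
  "compatible G s \<pi> l \<longleftrightarrow> (\<forall>q. circuit (ghost_graph G \<pi>) q \<longrightarrow>
     circuit_sum G s \<pi> l q \<le> 0 \<and>
     (circuit_sum G s \<pi> l q = 0 \<longleftrightarrow> fst ` q \<subseteq> Inl ` arcs (integer_graph G s \<pi>)))"

definition open_cone ::
  "('v, 'e::finite) pre_digraph \<Rightarrow> ('e \<times> bool \<Rightarrow> int) \<Rightarrow> ('v \<Rightarrow> 'l::linorder) \<Rightarrow> (real ^ 'e) set"
where
  "open_cone G s \<pi> = {l \<in> pos_lengths G. compatible G s \<pi> l}"

definition closed_cone ::
  "('v, 'e::finite) pre_digraph \<Rightarrow> ('e \<times> bool \<Rightarrow> int) \<Rightarrow> ('v \<Rightarrow> 'l::linorder) \<Rightarrow> (real ^ 'e) set"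
where
  "closed_cone G s \<pi> = {l \<in> nonneg_lengths G.
     \<forall>q. circuit (ghost_graph G \<pi>) q \<longrightarrow> circuit_sum G s \<pi> l q \<le> 0}"

end

theory Submission
  imports Defs
begin

text \<open>
  Both cones are described by potentials on the levels. Call \<open>f\<close> a potential for \<open>l\<close> if
  \<open>l a * s a \<le> f (tail a) - f (head a)\<close> for every arrow \<open>a\<close> of the ghost graph of finite slope.
  Potentials exist iff no circuit has positive weight: let \<open>f x\<close> be the maximal weight of a walk
  from \<open>x\<close> with pairwise distinct tails. Adding a small \<open>\<epsilon>\<close> to the weights of the non-integer
  arrows gives a potential that is strict on these, under the circuit condition of compatibility.
  The height functions \<open>h\<close> realizing \<open>(s, \<pi>)\<close> are exactly the strict potentials: the inequalities
  for \<open>a\<close> and its reverse pin down the floor, and those for descending ghost arrows say that \<open>h\<close>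
  induces \<open>\<pi>\<close>. Hence both cones are cut out by linear conditions on the pair \<open>(l, f)\<close>. Integer
  arrows are tight for every potential, so the weak conditions that become strict in the open cone
  are the only ones that matter for the relative interior.
\<close>

section \<open>Potentials and cycles in a finite digraph\<close>

text \<open>A cycle is kept as an ordered list over bare tail and head functions, so that walks can
  be extended and cut, and arrows can be restricted to any set \<open>A\<close>.\<close>

definition arc_cycle :: "('b \<Rightarrow> 'a) \<Rightarrow> ('b \<Rightarrow> 'a) \<Rightarrow> 'b list \<Rightarrow> bool" where
  "arc_cycle t h as \<longleftrightarrow> as \<noteq> [] \<and> successively (\<lambda>a b. h a = t b) as \<and>
     h (last as) = t (hd as) \<and> distinct (map t as)"

text \<open>\<open>N\<close> marks the arrows whose inequality must be strict: \<open>{}\<close>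
  will describe the closed cone, \<open>strict_arrows\<close> the open one.\<close>

definition potential ::
  "('b \<Rightarrow> 'a) \<Rightarrow> ('b \<Rightarrow> 'a) \<Rightarrow> 'b set \<Rightarrow> ('b \<Rightarrow> real) \<Rightarrow> 'b set \<Rightarrow> ('a \<Rightarrow> real) \<Rightarrow> bool" where
  "potential t h A w N f \<longleftrightarrow> (\<forall>a\<in>A. w a \<le> f (t a) - f (h a) \<and>
     (a \<in> N \<longrightarrow> w a < f (t a) - f (h a)))"

lemma potential_weaken: "potential t h A w N f \<Longrightarrow> potential t h A w {} f"
  by (simp add: potential_def)

lemma walk_telescope:
  fixes f :: "'a \<Rightarrow> real"
  assumes "as \<noteq> []" "successively (\<lambda>a b. h a = t b) as"
  shows "(\<Sum>a\<leftarrow>as. f (t a) - f (h a)) = f (t (hd as)) - f (h (last as))"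
  using assms by (induction as rule: induct_list012) auto

lemma arc_cycle_telescope:
  fixes f :: "'a \<Rightarrow> real"
  assumes "arc_cycle t h as"
  shows "(\<Sum>a\<in>set as. f (t a) - f (h a)) = 0"
proof -
  have "distinct as"
    using assms by (auto simp: arc_cycle_def distinct_map)
  then have "(\<Sum>a\<in>set as. f (t a) - f (h a)) = (\<Sum>a\<leftarrow>as. f (t a) - f (h a))"
    by (simp add: sum_list_distinct_conv_sum_set)
  also have "\<dots> = 0"
    using assms walk_telescope[of as h t f] by (simp add: arc_cycle_def)
  finally show ?thesis .
qed

text \<open>Prepend \<open>a\<close> to an optimal walk from \<open>h a\<close>. Either the tails
  stay distinct, and the result competes in the maximum at \<open>t a\<close>, or a cycle closes; it
  has weight at most 0, so dropping it loses nothing.\<close>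

lemma weak_potential_exists:
  fixes w :: "'b \<Rightarrow> real"
  assumes fin: "finite A"
    and cyc: "\<And>as. arc_cycle t h as \<Longrightarrow> set as \<subseteq> A \<Longrightarrow> sum w (set as) \<le> 0"
  shows "\<exists>f. \<forall>a\<in>A. w a \<le> f (t a) - f (h a)"
proof -
  define P where "P x = {as. set as \<subseteq> A \<and> successively (\<lambda>a b. h a = t b) as \<and>
    distinct (map t as) \<and> (as = [] \<or> t (hd as) = x)}" for x
  define f where "f x = Max ((\<lambda>as. sum w (set as)) ` P x)" for x
  have finP: "finite (P x)" for x
  proof (rule finite_subset)
    show "P x \<subseteq> {as. set as \<subseteq> A \<and> length as \<le> card A}"
      using fin by (auto simp: P_def distinct_map dest!: distinct_card[symmetric] intro: card_mono)
    show "finite {as. set as \<subseteq> A \<and> length as \<le> card A}"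
      using finite_lists_length_le[OF fin] .
  qed
  have ge: "sum w (set as) \<le> f x" if "as \<in> P x" for as x
    unfolding f_def using that finP by (intro Max_ge) auto
  have "w a \<le> f (t a) - f (h a)" if a: "a \<in> A" for a
  proof -
    have "[] \<in> P (h a)"
      by (simp add: P_def)
    then have "f (h a) \<in> (\<lambda>as. sum w (set as)) ` P (h a)"
      unfolding f_def using finP by (intro Max_in) auto
    then obtain as where as: "as \<in> P (h a)" and f: "f (h a) = sum w (set as)"
      by blast
    have "w a + sum w (set as) \<le> f (t a)"
    proof (cases "\<exists>b\<in>set as. t b = t a")
      case False
      then have "a # as \<in> P (t a)"
        using as a by (cases as) (auto simp: P_def)
      moreover have "a \<notin> set as"
        using False by blast
      ultimately show ?thesis
        using ge[of "a # as" "t a"] by simp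
    next
      case True
      \<comment> \<open>\<open>b\<close> is the first arrow of the walk with tail
        \<open>t a\<close>. Hence \<open>a # ys\<close> is a cycle, and the remainder
        \<open>b # zs\<close> is again a walk from \<open>t a\<close>.\<close>
      then obtain ys b zs where split: "as = ys @ b # zs" "t b = t a" "\<forall>y\<in>set ys. t y \<noteq> t a"
        using split_list_first_prop[of as "\<lambda>b. t b = t a"] by blast
      have "arc_cycle t h (a # ys)"
        using as split(2,3) unfolding split(1)
        by (cases "ys = []") (auto simp: P_def arc_cycle_def successively_append_iff successively_Cons)
      moreover have "set (a # ys) \<subseteq> A"
        using as split a by (auto simp: P_def)
      ultimately have "sum w (set (a # ys)) \<le> 0"
        by (rule cyc)
      moreover have "a \<notin> set ys"
        using split by blast
      moreover have "b # zs \<in> P (t a)"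
        using as split by (auto simp: P_def successively_append_iff)
      then have "sum w (set (b # zs)) \<le> f (t a)"
        by (rule ge)
      moreover have "sum w (set as) = sum w (set ys) + sum w (set (b # zs))"
      proof -
        have "set ys \<inter> set (b # zs) = {}"
          using as split by (auto simp: P_def distinct_map)
        then show ?thesis
          unfolding split by (simp add: sum.union_disjoint del: set_simps)
      qed
      ultimately show ?thesis
        by simp
    qed
    then show ?thesis
      using f by simp
  qed
  then show ?thesis
    by blast
qed

text \<open>Summing the inequalities around a cycle telescopes to 0, which gives one direction. For
  the other, cycles meeting \<open>N\<close> have negative weight, so raising the weights on
  \<open>N\<close> slightly creates no positive cycle.\<close>

lemma potential_iff_arc_cycles:
  fixes w :: "'b \<Rightarrow> real"
  assumes fin: "finite A"
  shows "(\<exists>f. potential t h A w N f) \<longleftrightarrow>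
    (\<forall>as. arc_cycle t h as \<and> set as \<subseteq> A \<longrightarrow>
       sum w (set as) \<le> 0 \<and> (set as \<inter> N \<noteq> {} \<longrightarrow> sum w (set as) < 0))" (is "_ \<longleftrightarrow> ?R")
proof
  assume "\<exists>f. potential t h A w N f"
  then obtain f where f: "potential t h A w N f"
    by blast
  have "sum w (set as) \<le> 0 \<and> (set as \<inter> N \<noteq> {} \<longrightarrow> sum w (set as) < 0)"
    if as: "arc_cycle t h as" "set as \<subseteq> A" for as
  proof -
    have le: "w a \<le> f (t a) - f (h a)" if "a \<in> set as" for a
      using f as that by (auto simp: potential_def)
    then have "sum w (set as) \<le> 0"
      using sum_mono[of "set as" w "\<lambda>a. f (t a) - f (h a)"] arc_cycle_telescope[OF as(1), of f]
      by simp
    moreover have "sum w (set as) < 0" if "set as \<inter> N \<noteq> {}"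
    proof -
      have "\<exists>a\<in>set as. w a < f (t a) - f (h a)"
        using f as that by (fastforce simp: potential_def)
      then have "sum w (set as) < (\<Sum>a\<in>set as. f (t a) - f (h a))"
        using le by (intro sum_strict_mono_ex1) auto
      then show ?thesis
        using arc_cycle_telescope[OF as(1), of f] by simp
    qed
    ultimately show ?thesis
      by blast
  qed
  then show ?R
    by blast
next
  assume R: ?R
  \<comment> \<open>All negative subsets of \<open>A\<close>, a finite family containing every cycle
    that meets \<open>N\<close>; one \<epsilon> then serves for all of them.\<close>
  define Q where "Q = {q. q \<subseteq> A \<and> sum w q < 0}"
  have "\<forall>\<^sub>F \<epsilon> in at_right 0. sum w q + \<epsilon> * real (card (q \<inter> N)) < 0" if "q \<in> Q" for q
  proof -
    have "((\<lambda>\<epsilon>. sum w q + \<epsilon> * real (card (q \<inter> N))) \<longlongrightarrow> sum w q + 0 * real (card (q \<inter> N))) (at_right 0)"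
      by (intro tendsto_intros)
    then show ?thesis
      using that by (intro order_tendstoD(2)) (auto simp: Q_def)
  qed
  then have "\<forall>\<^sub>F \<epsilon> in at_right 0. \<forall>q\<in>Q. sum w q + \<epsilon> * real (card (q \<inter> N)) < 0"
    using fin by (intro eventually_ball_finite) (auto simp: Q_def)
  moreover have "\<forall>\<^sub>F \<epsilon>::real in at_right 0. 0 < \<epsilon>"
    by (simp add: eventually_at_right_less)
  ultimately have "\<forall>\<^sub>F \<epsilon>::real in at_right 0. 0 < \<epsilon> \<and> (\<forall>q\<in>Q. sum w q + \<epsilon> * real (card (q \<inter> N)) < 0)"
    by eventually_elim blast
  from eventually_happens'[OF trivial_limit_at_right_real this]
  obtain \<epsilon> :: real where \<epsilon>: "0 < \<epsilon>" "\<forall>q\<in>Q. sum w q + \<epsilon> * real (card (q \<inter> N)) < 0"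
    by blast
  \<comment> \<open>A weak potential for \<open>w'\<close> exceeds \<open>w\<close> by at least
    \<epsilon> on \<open>N\<close>, hence is strict there.\<close>
  define w' where "w' a = w a + (if a \<in> N then \<epsilon> else 0)" for a
  have sum_w': "sum w' (set as) = sum w (set as) + \<epsilon> * real (card (set as \<inter> N))" for as
    by (simp add: w'_def sum.distrib sum.If_cases mult.commute)
  have "sum w' (set as) \<le> 0" if as: "arc_cycle t h as" "set as \<subseteq> A" for as
  proof (cases "set as \<inter> N = {}")
    case True
    then show ?thesis
      using R as by (simp add: sum_w')
  next
    case False
    then have "set as \<in> Q"
      using R as by (simp add: Q_def)
    then show ?thesis
      using \<epsilon> by (simp add: sum_w' less_imp_le)
  qed
  from weak_potential_exists[OF fin this]
  obtain f where "\<forall>a\<in>A. w' a \<le> f (t a) - f (h a)"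
    by blast
  then have "potential t h A w N f"
    using \<epsilon>(1) by (fastforce simp: potential_def w'_def split: if_splits)
  then show "\<exists>f. potential t h A w N f"
    by blast
qed

text \<open>The inequality of an opposite arrow with negated weight is the reverse of that of
  \<open>a\<close>, so both are equalities and the sum telescopes exactly.\<close>

lemma arc_cycle_tight_sum:
  assumes f: "potential t h A w N f"
    and as: "arc_cycle t h as" "set as \<subseteq> A"
    and tight: "\<And>a. a \<in> set as \<Longrightarrow> \<exists>b\<in>A. w b = - w a \<and> t b = h a \<and> h b = t a"
  shows "sum w (set as) = 0"
proof -
  have "w a = f (t a) - f (h a)" if a: "a \<in> set as" for a
  proof -
    obtain b where "b \<in> A" "w b = - w a" "t b = h a" "h b = t a"
      using tight[OF a] by blast
    moreover have "a \<in> A"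
      using a as by blast
    ultimately show ?thesis
      using f unfolding potential_def by (smt (verit))
  qed
  then have "sum w (set as) = (\<Sum>a\<in>set as. f (t a) - f (h a))"
    by (rule sum.cong[OF refl])
  then show ?thesis
    using arc_cycle_telescope[OF as(1), of f] by simp
qed

section \<open>Arrows and circuit sums of the ghost graph\<close>

lemma circuit_iff_arc_cycle:
  "circuit D q \<longleftrightarrow>
    (\<exists>as. arc_cycle (arrow_tail D) (arrow_head D) as \<and> set as = q \<and> q \<subseteq> arrows D)"
  by (auto simp: circuit_def arc_cycle_def successively_conv_nth)

lemma arrows_simp: "arrows D = arcs D \<times> UNIV"
  by (simp add: arrow_digraph_def)

lemma arrow_tail_simp: "arrow_tail D (e, b) = (if b then tail D e else head D e)"
  by (simp add: arrow_digraph_def)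

lemma arrow_head_simp: "arrow_head D (e, b) = (if b then head D e else tail D e)"
  by (simp add: arrow_digraph_def)

lemma arrow_tail_ghost_Inl: "arrow_tail (ghost_graph G \<pi>) (Inl e, b) = \<pi> (arrow_tail G (e, b))"
  by (simp add: arrow_digraph_def ghost_graph_def level_graph_def)

lemma arrow_head_ghost_Inl: "arrow_head (ghost_graph G \<pi>) (Inl e, b) = \<pi> (arrow_head G (e, b))"
  by (simp add: arrow_digraph_def ghost_graph_def level_graph_def)

lemma arrow_tail_ghost_Inr:
  "arrow_tail (ghost_graph G \<pi>) (Inr g, b) = (if b then fst g else snd g)"
  by (simp add: arrow_digraph_def ghost_graph_def level_graph_def)

lemma arrow_head_ghost_Inr:
  "arrow_head (ghost_graph G \<pi>) (Inr g, b) = (if b then snd g else fst g)"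
  by (simp add: arrow_digraph_def ghost_graph_def level_graph_def)

lemmas arrow_simps = arrow_tail_ghost_Inl arrow_head_ghost_Inl arrow_tail_ghost_Inr
  arrow_head_ghost_Inr

lemma arcs_ghost:
  "arcs (ghost_graph G \<pi>) = Inl ` {e \<in> arcs G. \<pi> (tail G e) \<noteq> \<pi> (head G e)} \<union>
     Inr ` {(x, y). x \<in> \<pi> ` verts G \<and> y \<in> \<pi> ` verts G \<and> x < y}"
  by (simp add: ghost_graph_def level_graph_def)

text \<open>A ghost arrow has slope \<open>-\<infinity>\<close> iff it follows the orientation of its ghost edge.\<close>

definition finite_arrows ::
  "('v, 'e) pre_digraph \<Rightarrow> ('v \<Rightarrow> 'l::linorder) \<Rightarrow> (('e + 'l \<times> 'l) \<times> bool) set" where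
  "finite_arrows G \<pi> = arrows (ghost_graph G \<pi>) - range Inr \<times> {True}"

text \<open>As a complement it includes all ghost arrows; a circuit avoids it exactly when it runs
  inside \<open>integer_graph\<close>.\<close>

definition strict_arrows ::
  "('v, 'e) pre_digraph \<Rightarrow> ('e \<times> bool \<Rightarrow> int) \<Rightarrow> ('v \<Rightarrow> 'l::linorder) \<Rightarrow>
    (('e + 'l \<times> 'l) \<times> bool) set" where
  "strict_arrows G s \<pi> = {a. fst a \<notin> Inl ` arcs (integer_graph G s \<pi>)}"

text \<open>The real-valued summand of \<open>circuit_sum\<close> on \<open>finite_arrows\<close>,
  where ghost arrows have slope 0.\<close>

definition arrow_weight ::
  "('e \<times> bool \<Rightarrow> int) \<Rightarrow> real ^ 'e::finite \<Rightarrow> ('e + 'l \<times> 'l) \<times> bool \<Rightarrow> real" where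
  "arrow_weight s l a = (case fst a of Inl e \<Rightarrow> l $ e * real_of_int (s (e, snd a)) | Inr g \<Rightarrow> 0)"

abbreviation level_potential ::
  "('v, 'e::finite) pre_digraph \<Rightarrow> ('e \<times> bool \<Rightarrow> int) \<Rightarrow> ('v \<Rightarrow> 'l::linorder) \<Rightarrow> real ^ 'e \<Rightarrow>
    (('e + 'l \<times> 'l) \<times> bool) set \<Rightarrow> ('l \<Rightarrow> real) \<Rightarrow> bool" where
  "level_potential G s \<pi> l \<equiv> potential (arrow_tail (ghost_graph G \<pi>))
     (arrow_head (ghost_graph G \<pi>)) (finite_arrows G \<pi>) (arrow_weight s l)"

lemma arrow_weight_combination:
  "arrow_weight s (x *\<^sub>R l + y *\<^sub>R l') a = x * arrow_weight s l a + y * arrow_weight s l' a"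
  by (cases "fst a") (auto simp: arrow_weight_def algebra_simps)

lemma finite_arrows_finite:
  fixes G :: "('v, 'e::finite) pre_digraph"
  assumes "finite (verts G)"
  shows "finite (finite_arrows G \<pi>)"
proof -
  have "{(x, y). x \<in> \<pi> ` verts G \<and> y \<in> \<pi> ` verts G \<and> x < y} \<subseteq> \<pi> ` verts G \<times> \<pi> ` verts G"
    by blast
  then have "finite {(x, y). x \<in> \<pi> ` verts G \<and> y \<in> \<pi> ` verts G \<and> x < y}"
    using assms by (meson finite_SigmaI finite_imageI finite_subset)
  then show ?thesis
    by (simp add: finite_arrows_def arrows_simp arcs_ghost)
qed

text \<open>No summand is \<infinity>, so a single ghost arrow of slope -\<infinity> drags the whole
  sum to -\<infinity>. Thus only circuits within \<open>finite_arrows\<close> constrain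
  \<open>l\<close>.\<close>

lemma circuit_sum_eq:
  assumes "q \<subseteq> arrows (ghost_graph G \<pi>)" "finite q"
  shows "circuit_sum G s \<pi> l q =
    (if q \<subseteq> finite_arrows G \<pi> then ereal (sum (arrow_weight s l) q) else - \<infinity>)"
proof -
  have fin: "ereal (ext_length l (fst a)) * ext_slope G s \<pi> a = ereal (arrow_weight s l a)"
    if "a \<in> finite_arrows G \<pi>" for a
    using that
    by (auto simp: finite_arrows_def arrows_simp arcs_ghost ext_length_def ext_slope_def
      arrow_weight_def arrow_simps split: if_splits)
  have inf: "ereal (ext_length l (fst a)) * ext_slope G s \<pi> a = - \<infinity>"
    if "a \<in> q" "a \<notin> finite_arrows G \<pi>" for a
    using that assms(1)
    by (auto simp: finite_arrows_def arrows_simp arcs_ghost ext_length_def ext_slope_def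
      arrow_weight_def arrow_simps split: if_splits)
  show ?thesis
  proof (cases "q \<subseteq> finite_arrows G \<pi>")
    case True
    then have "circuit_sum G s \<pi> l q = (\<Sum>a\<in>q. ereal (arrow_weight s l a))"
      unfolding circuit_sum_def using fin by (intro sum.cong) auto
    then show ?thesis
      using True by simp
  next
    case False
    then obtain a where a: "a \<in> q" "a \<notin> finite_arrows G \<pi>"
      by blast
    have "ereal (ext_length l (fst b)) * ext_slope G s \<pi> b \<noteq> \<infinity>" if "b \<in> q" for b
      using fin[of b] inf[OF that] by (metis MInfty_neq_PInfty(1) PInfty_neq_ereal(1))
    then have "(\<Sum>b\<in>q - {a}. ereal (ext_length l (fst b)) * ext_slope G s \<pi> b) \<noteq> \<infinity>"
      by (simp add: sum_Pinfty)
    then have "circuit_sum G s \<pi> l q = - \<infinity>"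
      unfolding circuit_sum_def sum.remove[OF assms(2) a(1)] inf[OF a] by simp
    then show ?thesis
      using False by simp
  qed
qed

lemma circuit_sum_arc_cycle:
  assumes "set as \<subseteq> arrows (ghost_graph G \<pi>)"
  shows "circuit_sum G s \<pi> l (set as) =
    (if set as \<subseteq> finite_arrows G \<pi> then ereal (sum (arrow_weight s l) (set as)) else - \<infinity>)"
  using circuit_sum_eq[OF assms] by simp

lemma finite_arrows_subset: "finite_arrows G \<pi> \<subseteq> arrows (ghost_graph G \<pi>)"
  by (auto simp: finite_arrows_def)

section \<open>The cones described by potentials\<close>

lemma closed_cone_iff_potential:
  fixes G :: "('v, 'e::finite) pre_digraph"
  assumes "finite (verts G)"
  shows "l \<in> closed_cone G s \<pi> \<longleftrightarrow>
    l \<in> nonneg_lengths G \<and> (\<exists>f. level_potential G s \<pi> l {} f)"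
  unfolding potential_iff_arc_cycles[OF finite_arrows_finite[OF assms]]
  using finite_arrows_subset[of G \<pi>]
  by (fastforce simp: closed_cone_def circuit_iff_arc_cycle circuit_sum_arc_cycle)

text \<open>The two arrows of an integer edge have opposite slopes. This makes every potential tight
  on them.\<close>

lemma non_strict_arrow_reverse:
  assumes "a \<in> finite_arrows G \<pi>" "a \<notin> strict_arrows G s \<pi>"
  shows "\<exists>b\<in>finite_arrows G \<pi>. arrow_weight s l b = - arrow_weight s l a \<and>
    arrow_tail (ghost_graph G \<pi>) b = arrow_head (ghost_graph G \<pi>) a \<and>
    arrow_head (ghost_graph G \<pi>) b = arrow_tail (ghost_graph G \<pi>) a \<and>
    b \<notin> strict_arrows G s \<pi>"
proof -
  obtain e b where a: "a = (Inl e, b)" and e: "e \<in> arcs (integer_graph G s \<pi>)"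
    using assms by (cases a) (auto simp: strict_arrows_def)
  have "s (e, \<not> b) = - s (e, b)"
    using e by (cases b) (auto simp: integer_graph_def)
  then show ?thesis
    using assms e
    by (intro bexI[of _ "(Inl e, \<not> b)"])
      (auto simp: a arrow_weight_def finite_arrows_def arrows_simp arrow_simps
        arrow_tail_simp arrow_head_simp strict_arrows_def)
qed

text \<open>That zero sums occur only on integer circuits is the strictness in the cycle criterion.
  The converse half, that integer circuits have sum zero, follows from tightness once a potential
  exists.\<close>

lemma compatible_iff_potential:
  fixes G :: "('v, 'e::finite) pre_digraph"
  assumes "finite (verts G)"
  shows "compatible G s \<pi> l \<longleftrightarrow> (\<exists>f. level_potential G s \<pi> l (strict_arrows G s \<pi>) f)"
    (is "?L \<longleftrightarrow> ?R")
proof -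
  let ?t = "arrow_tail (ghost_graph G \<pi>)" and ?h = "arrow_head (ghost_graph G \<pi>)"
  let ?N = "strict_arrows G s \<pi>" and ?A = "finite_arrows G \<pi>" and ?w = "arrow_weight s l"
  have int: "fst ` q \<subseteq> Inl ` arcs (integer_graph G s \<pi>) \<longleftrightarrow> q \<inter> ?N = {}" for q
    by (auto simp: strict_arrows_def)
  have int_fin: "q \<subseteq> ?A" if "q \<inter> ?N = {}" "q \<subseteq> arrows (ghost_graph G \<pi>)" for q
    using that by (auto simp: strict_arrows_def finite_arrows_def)
  have R: "?R \<longleftrightarrow> (\<forall>as. arc_cycle ?t ?h as \<and> set as \<subseteq> ?A \<longrightarrow>
     sum ?w (set as) \<le> 0 \<and> (set as \<inter> ?N \<noteq> {} \<longrightarrow> sum ?w (set as) < 0))"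
    using potential_iff_arc_cycles[OF finite_arrows_finite[OF assms]] .
  show ?thesis
  proof
    assume L: ?L
    have "sum ?w (set as) \<le> 0 \<and> (set as \<inter> ?N \<noteq> {} \<longrightarrow> sum ?w (set as) < 0)"
      if as: "arc_cycle ?t ?h as" "set as \<subseteq> ?A" for as
    proof -
      have sub: "set as \<subseteq> arrows (ghost_graph G \<pi>)"
        using as(2) finite_arrows_subset by blast
      then have "circuit (ghost_graph G \<pi>) (set as)"
        using as by (auto simp: circuit_iff_arc_cycle)
      then have "ereal (sum ?w (set as)) \<le> 0"
        "ereal (sum ?w (set as)) = 0 \<longleftrightarrow> set as \<inter> ?N = {}"
        using L as(2) by (auto simp: compatible_def int circuit_sum_arc_cycle[OF sub])
      then show ?thesis
        by (auto simp: order.strict_iff_order)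
    qed
    then show ?R
      unfolding R by blast
  next
    assume R': ?R
    then obtain f where f: "level_potential G s \<pi> l ?N f"
      by blast
    have "circuit_sum G s \<pi> l (set as) \<le> 0 \<and>
        (circuit_sum G s \<pi> l (set as) = 0 \<longleftrightarrow> set as \<inter> ?N = {})"
      if as: "arc_cycle ?t ?h as" "set as \<subseteq> arrows (ghost_graph G \<pi>)" for as
    proof (cases "set as \<subseteq> ?A")
      case False
      \<comment> \<open>The sum is -\<infinity>, hence nonzero, and a ghost arrow on the circuit
        keeps it out of the integer graph: both sides of the equivalence fail.\<close>
      then show ?thesis
        using int_fin[OF _ as(2)] by (auto simp: circuit_sum_arc_cycle[OF as(2)])
    next
      case True
      have "sum ?w (set as) = 0" if "set as \<inter> ?N = {}"
        using non_strict_arrow_reverse[of _ G \<pi> s l] True that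
        by (intro arc_cycle_tight_sum[OF f as(1) True]) blast
      moreover have "sum ?w (set as) \<le> 0" "set as \<inter> ?N \<noteq> {} \<longrightarrow> sum ?w (set as) < 0"
        using R' as(1) True unfolding R by blast+
      ultimately show ?thesis
        using True by (auto simp: circuit_sum_arc_cycle[OF as(2)])
    qed
    then show ?L
      by (auto simp: compatible_def int circuit_iff_arc_cycle)
  qed
qed

lemma open_cone_iff_potential:
  fixes G :: "('v, 'e::finite) pre_digraph"
  assumes "finite (verts G)"
  shows "l \<in> open_cone G s \<pi> \<longleftrightarrow>
    l \<in> pos_lengths G \<and> (\<exists>f. level_potential G s \<pi> l (strict_arrows G s \<pi>) f)"
  by (simp add: open_cone_def compatible_iff_potential[OF assms])

section \<open>Height functions as strict potentials\<close>

text \<open>Applied to the difference quotient \<open>x\<close> of a height function along an arrow: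
  the edge is integer exactly when \<open>x\<close> is an integer, so on other edges the floor bound
  is strict.\<close>

lemma floor_add_floor_minus: "\<lfloor>x\<rfloor> + \<lfloor>- x\<rfloor> = 0 \<longleftrightarrow> x = of_int \<lfloor>x\<rfloor>" for x :: real
  by linarith

lemma open_sigma_subset_open_cone:
  fixes G :: "('v, 'e::finite) pre_digraph"
  assumes "fin_digraph G"
  shows "open_sigma G s \<pi> \<subseteq> open_cone G s \<pi>"
proof
  interpret fin_digraph G by fact
  fix l assume "l \<in> open_sigma G s \<pi>"
  then obtain h where l: "l \<in> pos_lengths G"
    and slope: "\<And>a. a \<in> arrows G \<Longrightarrow> slope_of G l h a = s a" and levels: "same_levels G h \<pi>"
    by (auto simp: open_sigma_def)
  \<comment> \<open>\<open>h\<close> descends to levels through a chosen representative; the choice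
    is harmless because \<open>same_levels\<close> makes \<open>h\<close> constant on each
    level.\<close>
  define f where "f x = h (SOME v. v \<in> verts G \<and> \<pi> v = x)" for x
  have f: "f (\<pi> v) = h v" if "v \<in> verts G" for v
  proof -
    let ?u = "SOME u. u \<in> verts G \<and> \<pi> u = \<pi> v"
    have "?u \<in> verts G \<and> \<pi> ?u = \<pi> v"
      using that someI_ex[of "\<lambda>u. u \<in> verts G \<and> \<pi> u = \<pi> v"] by blast
    then have "h ?u = h v"
      using levels that unfolding same_levels_def by blast
    then show ?thesis
      by (simp only: f_def)
  qed
  have "level_potential G s \<pi> l (strict_arrows G s \<pi>) f"
    unfolding potential_def
  proof
    fix a assume a: "a \<in> finite_arrows G \<pi>"
    show "arrow_weight s l a \<le> f (arrow_tail (ghost_graph G \<pi>) a) - f (arrow_head (ghost_graph G \<pi>) a)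
      \<and> (a \<in> strict_arrows G s \<pi> \<longrightarrow>
        arrow_weight s l a < f (arrow_tail (ghost_graph G \<pi>) a) - f (arrow_head (ghost_graph G \<pi>) a))"
    proof (cases "fst a")
      case (Inr g)
      \<comment> \<open>A finite ghost arrow runs from the higher level \<pi> v to the lower \<pi> u
        with weight 0, so its inequality is \<open>h u < h v\<close>.\<close>
      then obtain u v where uv: "a = (Inr (\<pi> u, \<pi> v), False)" "u \<in> verts G" "v \<in> verts G" "\<pi> u < \<pi> v"
        using a by (cases a) (auto simp: finite_arrows_def arrows_simp arcs_ghost)
      then have "h u < h v"
        using levels unfolding same_levels_def by blast
      then show ?thesis
        using uv f by (auto simp: arrow_simps arrow_weight_def)
    next
      case (Inl e)
      then obtain b where b: "a = (Inl e, b)"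
        by (cases a) auto
      have e: "e \<in> arcs G" "\<pi> (tail G e) \<noteq> \<pi> (head G e)"
        using a b by (auto simp: finite_arrows_def arrows_simp arcs_ghost)
      have pos: "0 < l $ e"
        using l e by (auto simp: pos_lengths_def)
      define x where "x = (h (arrow_tail G (e, b)) - h (arrow_head G (e, b))) / l $ e"
      have vs: "arrow_tail G (e, b) \<in> verts G" "arrow_head G (e, b) \<in> verts G"
        using e by (auto simp: arrow_tail_simp arrow_head_simp)
      have minus_x: "- x = (h (arrow_tail G (e, \<not> b)) - h (arrow_head G (e, \<not> b))) / l $ e"
        by (simp only: x_def minus_divide_left minus_diff_eq) (simp add: arrow_tail_simp arrow_head_simp)
      have sx: "s (e, b) = \<lfloor>x\<rfloor>" "s (e, \<not> b) = \<lfloor>- x\<rfloor>"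
        using slope[of "(e, b)"] slope[of "(e, \<not> b)"] e(1)
        unfolding slope_of_def fst_conv minus_x x_def[symmetric] by (simp_all add: arrows_simp)
      have diff: "f (arrow_tail (ghost_graph G \<pi>) a) - f (arrow_head (ghost_graph G \<pi>) a) = l $ e * x"
        using pos by (simp add: b arrow_simps f vs x_def)
      have weight: "arrow_weight s l a = l $ e * of_int \<lfloor>x\<rfloor>"
        by (simp add: arrow_weight_def b sx)
      have "of_int \<lfloor>x\<rfloor> < x" if "a \<in> strict_arrows G s \<pi>"
      proof -
        have "s (e, b) + s (e, \<not> b) \<noteq> 0"
          using that e
          by (cases b) (auto simp: strict_arrows_def b integer_graph_def level_graph_def add.commute)
        then show ?thesis
          unfolding sx using floor_add_floor_minus[of x] of_int_floor_le[of x]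
          by (metis order.not_eq_order_implies_strict)
      qed
      then show ?thesis
        using pos by (auto simp: diff weight)
    qed
  qed
  then show "l \<in> open_cone G s \<pi>"
    using l by (auto simp: open_cone_iff_potential)
qed

text \<open>The height function is the pullback \<open>f \<circ> \<pi>\<close>. Vertical edges are
  governed by the potential, horizontal ones, which the level graph lacks, by the slope-level
  condition.\<close>

lemma open_cone_subset_open_sigma:
  fixes G :: "('v, 'e::finite) pre_digraph"
  assumes "fin_digraph G" and pair: "slope_level_pair G s \<pi>"
  shows "open_cone G s \<pi> \<subseteq> open_sigma G s \<pi>"
proof
  interpret fin_digraph G by fact
  fix l assume "l \<in> open_cone G s \<pi>"
  then obtain f where l: "l \<in> pos_lengths G"
    and f: "level_potential G s \<pi> l (strict_arrows G s \<pi>) f"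
    by (auto simp: open_cone_iff_potential)
  have mono: "f (\<pi> u) < f (\<pi> v)" if "u \<in> verts G" "v \<in> verts G" "\<pi> u < \<pi> v" for u v
  proof -
    let ?a = "(Inr (\<pi> u, \<pi> v), False)"
    have "?a \<in> finite_arrows G \<pi>" "?a \<in> strict_arrows G s \<pi>"
      using that by (auto simp: finite_arrows_def arrows_simp arcs_ghost strict_arrows_def)
    then have "arrow_weight s l ?a <
        f (arrow_tail (ghost_graph G \<pi>) ?a) - f (arrow_head (ghost_graph G \<pi>) ?a)"
      using f unfolding potential_def by blast
    then show ?thesis
      by (simp add: arrow_simps arrow_weight_def)
  qed
  then have "same_levels G (f \<circ> \<pi>) \<pi>"
    unfolding same_levels_def comp_def by (metis less_asym less_irrefl linorder_neqE)
  moreover have "slope_of G l (f \<circ> \<pi>) a = s a" if "a \<in> arrows G" for a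
  proof -
    obtain e b where a: "a = (e, b)"
      by (cases a)
    have e: "e \<in> arcs G" "0 < l $ e"
      using that l by (auto simp: a arrows_simp pos_lengths_def)
    have s: "s (e, b) + s (e, \<not> b) = -1 \<or> s (e, b) + s (e, \<not> b) = 0"
      using pair e by (auto simp: slope_level_pair_def slope_function_def arrows_simp reverse_def)
    define d where "d = f (\<pi> (arrow_tail G (e, b))) - f (\<pi> (arrow_head G (e, b)))"
    have "\<lfloor>d / l $ e\<rfloor> = s (e, b)"
    proof (cases "\<pi> (tail G e) = \<pi> (head G e)")
      case True
      \<comment> \<open>A horizontal edge has no arrow in \<open>A_\<pi> = A_s\<close>, so both its
        slopes are nonnegative; their sum is at most 0, so both vanish.\<close>
      have "(e, c) \<notin> level_arrows G \<pi>" for c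
        using True by (auto simp: level_arrows_def arrow_tail_simp arrow_head_simp)
      then have "(e, c) \<notin> slope_arrows G s" for c
        using pair by (simp add: slope_level_pair_def)
      from this[of b] this[of "\<not> b"] have "0 \<le> s (e, b)" "0 \<le> s (e, \<not> b)"
        using e by (auto simp: slope_arrows_def arrows_simp reverse_def)
      moreover have "d = 0"
        using True by (simp add: d_def arrow_tail_simp arrow_head_simp)
      ultimately show ?thesis
        using s by auto
    next
      case False
      have arr: "(Inl e, c) \<in> finite_arrows G \<pi>" for c
        using e False by (auto simp: finite_arrows_def arrows_simp arcs_ghost)
      have str: "(Inl e, c) \<in> strict_arrows G s \<pi>" if "s (e, b) + s (e, \<not> b) = -1" for c
        using that by (cases b) (auto simp: strict_arrows_def integer_graph_def)
      have pot: "l $ e * s (e, c) \<le> f (\<pi> (arrow_tail G (e, c))) - f (\<pi> (arrow_head G (e, c))) \<and>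
          ((Inl e, c) \<in> strict_arrows G s \<pi> \<longrightarrow>
            l $ e * s (e, c) < f (\<pi> (arrow_tail G (e, c))) - f (\<pi> (arrow_head G (e, c))))" for c
        using f[unfolded potential_def, THEN bspec, OF arr[of c]]
        by (simp add: arrow_weight_def arrow_simps)
      have minus_d: "f (\<pi> (arrow_tail G (e, \<not> b))) - f (\<pi> (arrow_head G (e, \<not> b))) = - d"
        by (simp add: d_def arrow_tail_simp arrow_head_simp)
      have w: "l $ e * s (e, b) \<le> d" "l $ e * s (e, \<not> b) \<le> - d"
        using pot[of b] pot[of "\<not> b"] by (simp_all only: minus_d d_def)
      \<comment> \<open>The strict upper bound needed for the floor comes from the reverse arrow.
        With slope sum -1 it is the strict inequality of that arrow; with sum 0 the weak one gives
        \<open>d \<le> l $ e * s (e, b)\<close>, and the edge length is positive.\<close>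
      have "d < l $ e * (s (e, b) + 1)"
        using s
      proof
        assume sum: "s (e, b) + s (e, \<not> b) = -1"
        then have eq: "real_of_int (s (e, \<not> b)) = - s (e, b) - 1"
          by linarith
        have "l $ e * s (e, \<not> b) < - d"
          using pot[of "\<not> b"] str[OF sum, of "\<not> b"] by (simp only: minus_d)
        then show ?thesis
          unfolding eq by (simp add: algebra_simps)
      next
        assume "s (e, b) + s (e, \<not> b) = 0"
        then have "s (e, \<not> b) = - s (e, b)"
          by simp
        then show ?thesis
          using w(2) e by (simp add: algebra_simps)
      qed
      then show ?thesis
        using w(1) e by (simp add: floor_eq_iff field_simps)
    qed
    then show ?thesis
      by (simp add: a slope_of_def d_def)
  qed
  ultimately show "l \<in> open_sigma G s \<pi>"
    using l unfolding open_sigma_def by blast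
qed

section \<open>Inclusion, convexity and closedness of the cones\<close>

lemma open_cone_subset_closed_cone:
  fixes G :: "('v, 'e::finite) pre_digraph"
  assumes "finite (verts G)"
  shows "open_cone G s \<pi> \<subseteq> closed_cone G s \<pi>"
proof -
  have "pos_lengths G \<subseteq> nonneg_lengths G"
    by (auto simp: pos_lengths_def nonneg_lengths_def less_imp_le)
  then show ?thesis
    unfolding subset_iff open_cone_iff_potential[OF assms] closed_cone_iff_potential[OF assms]
    using potential_weaken by blast
qed

text \<open>The conditions are linear in the length function and its potential jointly, so
  potentials combine with the same coefficients.\<close>

lemma closed_cone_combination:
  fixes G :: "('v, 'e::finite) pre_digraph"
  assumes fin: "finite (verts G)"
    and "l \<in> closed_cone G s \<pi>" "l' \<in> closed_cone G s \<pi>" "0 \<le> x" "0 \<le> y"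
  shows "x *\<^sub>R l + y *\<^sub>R l' \<in> closed_cone G s \<pi>"
proof -
  obtain f f' where f: "level_potential G s \<pi> l {} f" "level_potential G s \<pi> l' {} f'"
    using assms by (auto simp: closed_cone_iff_potential)
  have "level_potential G s \<pi> (x *\<^sub>R l + y *\<^sub>R l') {} (\<lambda>v. x * f v + y * f' v)"
    unfolding potential_def
  proof (intro ballI conjI impI)
    fix a assume "a \<in> finite_arrows G \<pi>"
    then have "x * arrow_weight s l a
        \<le> x * (f (arrow_tail (ghost_graph G \<pi>) a) - f (arrow_head (ghost_graph G \<pi>) a))"
      "y * arrow_weight s l' a
        \<le> y * (f' (arrow_tail (ghost_graph G \<pi>) a) - f' (arrow_head (ghost_graph G \<pi>) a))"
      using f assms(4,5) by (auto simp: potential_def intro!: mult_left_mono)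
    then show "arrow_weight s (x *\<^sub>R l + y *\<^sub>R l') a \<le>
        (x * f (arrow_tail (ghost_graph G \<pi>) a) + y * f' (arrow_tail (ghost_graph G \<pi>) a)) -
        (x * f (arrow_head (ghost_graph G \<pi>) a) + y * f' (arrow_head (ghost_graph G \<pi>) a))"
      by (simp add: arrow_weight_combination algebra_simps)
  qed simp
  moreover have "x *\<^sub>R l + y *\<^sub>R l' \<in> nonneg_lengths G"
    using assms by (auto simp: closed_cone_def nonneg_lengths_def)
  ultimately show ?thesis
    by (auto simp: closed_cone_iff_potential[OF fin])
qed

text \<open>A positive share of a strict solution keeps every strict inequality strict, for lengths
  as well as for potentials.\<close>

lemma closed_cone_open_cone_combination:
  fixes G :: "('v, 'e::finite) pre_digraph"
  assumes fin: "finite (verts G)"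
    and "l \<in> closed_cone G s \<pi>" "l' \<in> open_cone G s \<pi>" "0 \<le> x" "0 < y"
  shows "x *\<^sub>R l + y *\<^sub>R l' \<in> open_cone G s \<pi>"
proof -
  obtain f f' where f: "level_potential G s \<pi> l {} f"
    "level_potential G s \<pi> l' (strict_arrows G s \<pi>) f'"
    using assms by (auto simp: closed_cone_iff_potential open_cone_iff_potential)
  have "level_potential G s \<pi> (x *\<^sub>R l + y *\<^sub>R l') (strict_arrows G s \<pi>) (\<lambda>v. x * f v + y * f' v)"
    unfolding potential_def
  proof
    fix a assume a: "a \<in> finite_arrows G \<pi>"
    let ?d = "f (arrow_tail (ghost_graph G \<pi>) a) - f (arrow_head (ghost_graph G \<pi>) a)"
    let ?d' = "f' (arrow_tail (ghost_graph G \<pi>) a) - f' (arrow_head (ghost_graph G \<pi>) a)"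
    have "x * arrow_weight s l a \<le> x * ?d" "y * arrow_weight s l' a \<le> y * ?d'"
      "a \<in> strict_arrows G s \<pi> \<longrightarrow> y * arrow_weight s l' a < y * ?d'"
      using f a assms(4,5) by (auto simp: potential_def intro!: mult_left_mono)
    then show "arrow_weight s (x *\<^sub>R l + y *\<^sub>R l') a \<le>
        (x * f (arrow_tail (ghost_graph G \<pi>) a) + y * f' (arrow_tail (ghost_graph G \<pi>) a)) -
        (x * f (arrow_head (ghost_graph G \<pi>) a) + y * f' (arrow_head (ghost_graph G \<pi>) a)) \<and>
        (a \<in> strict_arrows G s \<pi> \<longrightarrow> arrow_weight s (x *\<^sub>R l + y *\<^sub>R l') a <
        (x * f (arrow_tail (ghost_graph G \<pi>) a) + y * f' (arrow_tail (ghost_graph G \<pi>) a)) -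
        (x * f (arrow_head (ghost_graph G \<pi>) a) + y * f' (arrow_head (ghost_graph G \<pi>) a)))"
      by (auto simp: arrow_weight_combination algebra_simps)
  qed
  moreover have "x *\<^sub>R l + y *\<^sub>R l' \<in> pos_lengths G"
    using assms
    by (auto simp: closed_cone_def open_cone_def nonneg_lengths_def pos_lengths_def
      intro!: add_nonneg_pos)
  ultimately show ?thesis
    by (auto simp: open_cone_iff_potential[OF fin])
qed

lemma convex_closed_cone:
  fixes G :: "('v, 'e::finite) pre_digraph"
  assumes "finite (verts G)"
  shows "convex (closed_cone G s \<pi>)"
  using closed_cone_combination[OF assms] by (auto simp: convex_def)

lemma zero_in_closed_cone:
  fixes G :: "('v, 'e::finite) pre_digraph"
  assumes "finite (verts G)"
  shows "0 \<in> closed_cone G s \<pi>"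
proof -
  have "level_potential G s \<pi> 0 {} (\<lambda>_. 0)"
    by (auto simp: potential_def arrow_weight_def split: sum.split)
  then show ?thesis
    by (auto simp: closed_cone_iff_potential[OF assms] nonneg_lengths_def)
qed

lemma closed_nonneg_lengths: "closed (nonneg_lengths G)"
  unfolding nonneg_lengths_def Ball_def
  by (intro closed_Collect_conj closed_Collect_all closed_Collect_imp
      closed_Collect_le closed_Collect_eq continuous_intros) auto

text \<open>An existential over potentials does not display closedness, so the cycle criterion is
  used instead: an intersection of closed conditions, each a linear inequality in
  \<open>l\<close>.\<close>

lemma closed_closed_cone:
  fixes G :: "('v, 'e::finite) pre_digraph"
  assumes "finite (verts G)"
  shows "closed (closed_cone G s \<pi>)"
proof -
  let ?C = "\<lambda>as. arc_cycle (arrow_tail (ghost_graph G \<pi>)) (arrow_head (ghost_graph G \<pi>)) as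
    \<and> set as \<subseteq> finite_arrows G \<pi>"
  have "continuous_on UNIV (\<lambda>l. arrow_weight s l a)" for a :: "('e + 'b \<times> 'b) \<times> bool"
    by (cases "fst a") (auto simp: arrow_weight_def intro!: continuous_intros)
  then have "closed {l. sum (arrow_weight s l) (set as) \<le> 0}" for as :: "(('e + 'b \<times> 'b) \<times> bool) list"
    by (intro closed_Collect_le continuous_intros) auto
  then have "closed (nonneg_lengths G \<inter> (\<Inter>as\<in>Collect ?C. {l. sum (arrow_weight s l) (set as) \<le> 0}))"
    by (intro closed_Int closed_nonneg_lengths closed_INT) auto
  also have "nonneg_lengths G \<inter> (\<Inter>as\<in>Collect ?C. {l. sum (arrow_weight s l) (set as) \<le> 0})
      = closed_cone G s \<pi>"
    by (auto simp: closed_cone_iff_potential[OF assms]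
      potential_iff_arc_cycles[OF finite_arrows_finite[OF assms]])
  finally show ?thesis .
qed

section \<open>The relative interior of the closed cone\<close>

text \<open>At parameter 1 the expressions equal \<open>c i > 0\<close>; by continuity finitely many
  of them stay positive a little beyond 1.\<close>

lemma finite_strict_extrapolation:
  fixes c d :: "'i \<Rightarrow> real"
  assumes "finite S" "\<And>i. i \<in> S \<Longrightarrow> 0 < c i"
  shows "\<forall>\<^sub>F x in at_right 1. \<forall>i\<in>S. 0 < (1 - x) * d i + x * c i"
proof (intro eventually_ball_finite assms(1) ballI)
  fix i assume "i \<in> S"
  have "((\<lambda>x. (1 - x) * d i + x * c i) \<longlongrightarrow> (1 - 1) * d i + 1 * c i) (at_right 1)"
    by (intro tendsto_intros)
  then show "\<forall>\<^sub>F x in at_right 1. 0 < (1 - x) * d i + x * c i"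
    using assms(2)[OF \<open>i \<in> S\<close>] by (intro order_tendstoD(1)) auto
qed

text \<open>The segment from \<open>l'\<close> to \<open>l\<close> can be prolonged past
  \<open>l\<close>: strict conditions survive a small step, and integer arrows, tight at both ends,
  remain tight along the whole line.\<close>

lemma open_cone_extrapolation:
  fixes G :: "('v, 'e::finite) pre_digraph"
  assumes fin: "finite (verts G)"
    and l: "l \<in> open_cone G s \<pi>" and l': "l' \<in> closed_cone G s \<pi>"
  shows "\<exists>x>1. (1 - x) *\<^sub>R l' + x *\<^sub>R l \<in> closed_cone G s \<pi>"
proof -
  let ?t = "arrow_tail (ghost_graph G \<pi>)" and ?h = "arrow_head (ghost_graph G \<pi>)"
  let ?N = "strict_arrows G s \<pi>" and ?A = "finite_arrows G \<pi>"
  obtain f f' where f: "level_potential G s \<pi> l ?N f"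
    and f': "level_potential G s \<pi> l' {} f'"
    using assms by (auto simp: closed_cone_iff_potential open_cone_iff_potential)
  have tight: "arrow_weight s k a = g (?t a) - g (?h a)"
    if "level_potential G s \<pi> k M g" "a \<in> ?A" "a \<notin> ?N" for k M g a
    using non_strict_arrow_reverse[OF that(2,3), of k] that(1,2) unfolding potential_def
    by (smt (verit))
  \<comment> \<open>\<open>c\<close> and \<open>d\<close> are the slacks of the two potentials; the
    extrapolated potential has slack \<open>(1 - x) * d a + x * c a\<close>.\<close>
  define c where "c a = f (?t a) - f (?h a) - arrow_weight s l a" for a
  define d where "d a = f' (?t a) - f' (?h a) - arrow_weight s l' a" for a
  have "\<forall>\<^sub>F x in at_right 1. \<forall>a\<in>?A \<inter> ?N. 0 < (1 - x) * d a + x * c a"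
    using f finite_arrows_finite[OF fin]
    by (intro finite_strict_extrapolation) (auto simp: potential_def c_def)
  moreover have "\<forall>\<^sub>F x in at_right 1. \<forall>e\<in>arcs G. 0 < (1 - x) * (l' $ e) + x * (l $ e)"
    using l by (intro finite_strict_extrapolation) (auto simp: open_cone_def pos_lengths_def)
  moreover have "\<forall>\<^sub>F x::real in at_right 1. 1 < x"
    by (simp add: eventually_at_right_less)
  ultimately have "\<forall>\<^sub>F x in at_right 1. (\<forall>a\<in>?A \<inter> ?N. 0 < (1 - x) * d a + x * c a) \<and>
      (\<forall>e\<in>arcs G. 0 < (1 - x) * (l' $ e) + x * (l $ e)) \<and> 1 < x"
    by eventually_elim blast
  from eventually_happens'[OF trivial_limit_at_right_real this]
  obtain x where x: "\<forall>a\<in>?A \<inter> ?N. 0 < (1 - x) * d a + x * c a"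
    "\<forall>e\<in>arcs G. 0 < (1 - x) * (l' $ e) + x * (l $ e)" "1 < x"
    by blast
  have "level_potential G s \<pi> ((1 - x) *\<^sub>R l' + x *\<^sub>R l) {} (\<lambda>v. (1 - x) * f' v + x * f v)"
    unfolding potential_def
  proof (intro ballI conjI impI)
    fix a assume a: "a \<in> ?A"
    have "0 \<le> (1 - x) * d a + x * c a"
    proof (cases "a \<in> ?N")
      case True
      then show ?thesis
        using x(1) a by (simp add: less_imp_le)
    next
      case False
      then have "c a = 0" "d a = 0"
        using tight[OF f a] tight[OF f' a] by (simp_all add: c_def d_def)
      then show ?thesis
        by simp
    qed
    then show "arrow_weight s ((1 - x) *\<^sub>R l' + x *\<^sub>R l) a \<le>
        ((1 - x) * f' (?t a) + x * f (?t a)) - ((1 - x) * f' (?h a) + x * f (?h a))"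
      unfolding arrow_weight_combination c_def d_def by (simp add: algebra_simps)
  qed simp
  moreover have "(1 - x) *\<^sub>R l' + x *\<^sub>R l \<in> nonneg_lengths G"
    using x(2) l l' by (auto simp: closed_cone_def open_cone_def nonneg_lengths_def pos_lengths_def
      less_imp_le)
  ultimately show ?thesis
    using x(3) by (auto simp: closed_cone_iff_potential[OF fin])
qed

text \<open>Uses the criterion that a point of a convex set is relatively interior iff every segment
  of the set ending there can be prolonged.\<close>

lemma rel_interior_closed_cone:
  fixes G :: "('v, 'e::finite) pre_digraph"
  assumes fin: "finite (verts G)" and "open_cone G s \<pi> \<noteq> {}"
  shows "rel_interior (closed_cone G s \<pi>) = open_cone G s \<pi>"
proof -
  obtain l0 where l0: "l0 \<in> open_cone G s \<pi>"
    using assms(2) by blast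
  have iff: "l \<in> rel_interior (closed_cone G s \<pi>) \<longleftrightarrow>
      (\<forall>k\<in>closed_cone G s \<pi>. \<exists>x>1. (1 - x) *\<^sub>R k + x *\<^sub>R l \<in> closed_cone G s \<pi>)" for l
    using zero_in_closed_cone[OF fin]
    by (intro convex_rel_interior_iff convex_closed_cone[OF fin]) auto
  have "l \<in> open_cone G s \<pi>" if l: "l \<in> rel_interior (closed_cone G s \<pi>)" for l
  proof -
    obtain x where x: "1 < x" "(1 - x) *\<^sub>R l0 + x *\<^sub>R l \<in> closed_cone G s \<pi>"
      using l l0 open_cone_subset_closed_cone[OF fin, of s \<pi>] unfolding iff by blast
    \<comment> \<open>Undoing the prolongation writes \<open>l\<close> as a combination of a point
      of the closed cone and \<open>l0\<close>, the latter with positive coefficient since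
      \<open>x > 1\<close>.\<close>
    then have "(1 / x) *\<^sub>R ((1 - x) *\<^sub>R l0 + x *\<^sub>R l) + (1 - 1 / x) *\<^sub>R l0 \<in> open_cone G s \<pi>"
      using l0 by (intro closed_cone_open_cone_combination[OF fin]) auto
    moreover have "(1 / x) *\<^sub>R ((1 - x) *\<^sub>R l0 + x *\<^sub>R l) + (1 - 1 / x) *\<^sub>R l0 = l"
      using x(1) by (simp add: vec_eq_iff field_simps)
    ultimately show ?thesis
      by simp
  qed
  moreover have "l \<in> rel_interior (closed_cone G s \<pi>)" if "l \<in> open_cone G s \<pi>" for l
    unfolding iff using open_cone_extrapolation[OF fin that] by blast
  ultimately show ?thesis
    by blast
qed

theorem theorem9p2:
  fixes G :: "('v, 'e::finite) pre_digraph"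
    and s :: "'e \<times> bool \<Rightarrow> int"
    and \<pi> :: "'v \<Rightarrow> 'l::linorder"
  assumes "fin_digraph G"
    and "Digraph_Component.connected G"
    and "slope_level_pair G s \<pi>"
  shows "open_sigma G s \<pi> = open_cone G s \<pi>
    \<and> (open_sigma G s \<pi> \<noteq> {} \<longleftrightarrow> closed_sigma G s \<pi> = closed_cone G s \<pi>)
    \<and> (open_sigma G s \<pi> \<noteq> {} \<longrightarrow> open_sigma G s \<pi> = rel_interior (closed_sigma G s \<pi>))"
proof -
  interpret fin_digraph G by fact
  have fin: "finite (verts G)"
    by simp
  have sigma: "open_sigma G s \<pi> = open_cone G s \<pi>"
    using open_sigma_subset_open_cone open_cone_subset_open_sigma assms by blast
  have sub: "open_cone G s \<pi> \<subseteq> nonneg_lengths G" "closed_cone G s \<pi> \<subseteq> nonneg_lengths G"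
    by (auto simp: open_cone_def closed_cone_def pos_lengths_def nonneg_lengths_def less_imp_le)
  have cs: "closed_sigma G s \<pi> = nonneg_lengths G \<inter> closure (open_cone G s \<pi>)"
    using sub by (simp add: closed_sigma_def sigma closure_of_subtopology inf.absorb2)
  have nonempty: "closed_sigma G s \<pi> = closed_cone G s \<pi>" if "open_cone G s \<pi> \<noteq> {}"
  proof -
    \<comment> \<open>A convex set in finite dimension has the same closure as its relative
      interior, here the open cone.\<close>
    have "closure (open_cone G s \<pi>) = closure (closed_cone G s \<pi>)"
      using convex_closure_rel_interior[OF convex_closed_cone[OF fin], of s \<pi>]
      by (simp add: rel_interior_closed_cone[OF fin that])
    then show ?thesis
      using sub closed_closed_cone[OF fin, of s \<pi>] by (auto simp: cs)
  qed
  \<comment> \<open>The closed cone always contains 0, whereas the closure of an empty open cone is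
    empty.\<close>
  have "closed_sigma G s \<pi> \<noteq> closed_cone G s \<pi>" if "open_cone G s \<pi> = {}"
    using zero_in_closed_cone[OF fin, of s \<pi>] that by (auto simp: cs)
  then show ?thesis
    using nonempty sigma rel_interior_closed_cone[OF fin] by metis
qed

end
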